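(* Let $m\ge 2$ be an integer, let $\lambda>0$, and let $0<a<m-1$. Put $\Delta_m(a):=\frac{m-3-2a}{2m}$. Then for every sufficiently large integer $N$ there exist a real number $x_N>0$, an integer $H_N$ with $1\le H_N<N/2$, and $M_N\in\{N-H_N,\,N\}$ such that $$x_N=\lambda N^a\left(1+O_{m,a,\lambda}\bigl(N^{-(a+1)/m}\bigr)\right),\qquad H_N\asymp_{m,a,\lambda}N^{1-(a+1)/m},$$ and $$|\mathcal B_m(x_N,M_N)|\gg_{m,a,\lambda}N^{\Delta_m(a)}.$$ More precisely, $$|\mathcal B_m(x_N,N)-\mathcal B_m(x_N,N-H_N)|\gg_{m,a,\lambda}N^{\Delta_m(a)}.$$
   Context: For an integer $m\ge2$, let $d_m(n):=\#\{(n_1,\ldots,n_m)\in\mathbb N^m: n_1\cdots n_m=n\}$ with $\mathbb N=\{1,2,\ldots\}$, let $\beta_m:=\frac{m+1}{2m}$ and $\phi_m:=\frac{\pi(m-3)}{4}$. For $x>0$ and a positive integer $M$ define $$\mathcal B_m(x,M):=\sum_{n\le M}d_m(n)\,n^{-\beta_m}\cos\!\left(2\pi m(nx)^{1/m}+\phi_m\right),$$ the sum being over positive integers $n\le M$. The notation $F\ll_{\mathcal P}G$, equivalently $F=O_{\mathcal P}(G)$, means $|F|\le C G$ with a constant $C$ depending only on the parameters $\mathcal P$ (so uniformly in $N$); $G\gg_{\mathcal P}F$ means $F\ll_{\mathcal P}G$, and $F\asymp_{\mathcal P}G$ means both $F\ll_{\mathcal P}G$ and $G\ll_{\mathcal P}F$.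 *)

theory Defs
  imports "HOL-Analysis.Analysis"
begin

definition divisor_fun :: "nat \<Rightarrow> nat \<Rightarrow> nat" where
  "divisor_fun m n = card {ns :: nat list. length ns = m \<and> (\<forall>k\<in>set ns. 1 \<le> k) \<and> prod_list ns = n}"

definition beta :: "nat \<Rightarrow> real" where
  "beta m = (real m + 1) / (2 * real m)"

definition phi :: "nat \<Rightarrow> real" where
  "phi m = pi * (real m - 3) / 4"

definition B_sum :: "nat \<Rightarrow> real \<Rightarrow> nat \<Rightarrow> real" where
  "B_sum m x M =
     (\<Sum>n = 1..M. real (divisor_fun m n) * real n powr (- beta m) *
        cos (2 * pi * real m * (real n * x) powr (1 / real m) + phi m))"

definition Delta :: "nat \<Rightarrow> real \<Rightarrow> real" where
  "Delta m a = (real m - 3 - 2 * a) / (2 * real m)"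

end

theory Submission
  imports Defs "HOL-Real_Asymp.Real_Asymp"
begin

text \<open>Choose \<open>x\<close> near \<open>\<lambda>N\<^sup>a\<close> so that the phase at \<open>n = N\<close> is a multiple of \<open>2\<pi>\<close>; consecutive
  such values of \<open>(N x)\<^bsup>1/m\<^esup> \<asymp> N\<^bsup>(a+1)/m\<^esup>\<close> are \<open>1/m\<close> apart, which gives the relative error in \<open>x\<close>.
  The phase has derivative of order \<open>N\<^bsup>(a+1)/m-1\<^esup>\<close> near \<open>N\<close>, so on a block of length
  \<open>H = c N\<^bsup>1-(a+1)/m\<^esup>\<close> below \<open>N\<close> all cosines are at least \<open>1/2\<close>. Since \<open>d\<^sub>m \<ge> 1\<close>, the block
  contributes at least \<open>H N\<^bsup>-\<beta>\<^esup> / 2\<close>, and one of the two partial sums carries half of this.\<close>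

text \<open>The tuple (n, 1, ..., 1) is a factorization. Since \<open>card\<close> of an infinite
  set is 0, finiteness matters too; it follows because every factor divides \<open>n \<ge> 1\<close>
  and so is at most \<open>n\<close>.\<close>

lemma divisor_fun_ge_1:
  assumes "m \<ge> 1" and "n \<ge> 1"
  shows "divisor_fun m n \<ge> 1"
proof -
  let ?S = "{ns :: nat list. length ns = m \<and> (\<forall>k\<in>set ns. 1 \<le> k) \<and> prod_list ns = n}"
  have "?S \<subseteq> {ns. set ns \<subseteq> {..n} \<and> length ns = m}"
  proof
    fix ns assume ns: "ns \<in> ?S"
    have "k \<le> n" if "k \<in> set ns" for k
    proof -
      have "k dvd prod_list ns"
        using that by (rule prod_list_dvd)
      with ns assms show ?thesis
        by (auto dest: dvd_imp_le)
    qed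
    with ns show "ns \<in> {ns. set ns \<subseteq> {..n} \<and> length ns = m}"
      by auto
  qed
  then have "finite ?S"
    by (rule finite_subset) (simp add: finite_lists_length_eq)
  moreover have "n # replicate (m - 1) 1 \<in> ?S"
    using assms by auto
  ultimately have "card ?S > 0"
    by (auto simp only: card_gt_0_iff)
  then show ?thesis
    unfolding divisor_fun_def by linarith
qed

lemma cos_ge_half:
  fixes t :: real
  assumes "\<bar>t\<bar> \<le> pi / 3"
  shows "cos t \<ge> 1 / 2"
proof -
  have "cos (pi / 3) \<le> cos \<bar>t\<bar>"
    using assms pi_gt_zero by (intro cos_monotone_0_pi_le) auto
  then show ?thesis
    by (simp add: cos_60)
qed

text \<open>With \<open>r = n / N\<close> the phase at \<open>n\<close> falls short of the one at
  \<open>N\<close> by \<open>2 * pi * real m * y * (1 - r powr (1 / real m))\<close>. Instead of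
  estimating a derivative, \<open>r powr (1 / real m) \<ge> r\<close> on [0, 1] bounds the last
  factor by \<open>(N - n) / N\<close>, and \<open>close\<close> makes the whole gap at most
  \<open>pi / 3\<close>.\<close>

lemma cos_phase_ge_half:
  fixes x y :: real and k :: int
  assumes m: "m \<ge> 1" and n: "n \<le> N" and N: "N > 0"
    and y: "y > 0" "real N * x = y ^ m"
    and k: "2 * pi * real m * y + phi m = 2 * pi * of_int k"
    and close: "6 * real m * y * real (N - n) \<le> real N"
  shows "cos (2 * pi * real m * (real n * x) powr (1 / real m) + phi m) \<ge> 1 / 2"
proof -
  define r where "r = real n / real N"
  have r: "0 \<le> r" "r \<le> 1"
    using n N by (auto simp: r_def)
  have "real n * x = r * y ^ m"
    using N y(2) by (simp add: r_def field_simps)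
  then have root: "(real n * x) powr (1 / real m) = r powr (1 / real m) * y"
    using y(1) r m
    by (simp add: powr_mult powr_powr flip: powr_realpow)
  define s where "s = r powr (1 / real m)"
  have s: "r \<le> s" "s \<le> 1"
  proof -
    show "s \<le> 1"
      using powr_mono2[of "1 / real m" r 1] r by (simp add: s_def)
    show "r \<le> s"
      using powr_mono'[of "1 / real m" 1 r] r m by (simp add: s_def)
  qed
  define t where "t = 2 * pi * real m * y * (1 - s)"
  have "real m * y * (1 - s) \<le> real m * y * (1 - r)"
    using s y by (intro mult_left_mono) auto
  also have "\<dots> \<le> 1 / 6"
    using close N n by (simp add: r_def field_simps of_nat_diff)
  finally have "real m * y * (1 - s) \<le> 1 / 6" .
  then have "2 * pi * (real m * y * (1 - s)) \<le> 2 * pi * (1 / 6)"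
    by (intro mult_left_mono) auto
  then have "\<bar>t\<bar> \<le> pi / 3"
    using s y by (simp add: t_def mult.assoc)
  then have "cos t \<ge> 1 / 2"
    by (rule cos_ge_half)
  moreover have "2 * pi * real m * (real n * x) powr (1 / real m) + phi m
      = of_int k * (2 * pi) - t"
    unfolding root using k by (simp add: t_def s_def algebra_simps)
  moreover have "cos (of_int k * (2 * pi) - t) = cos t"
    using cos_int_2pin[of k] sin_int_2pin[of k] by (simp add: cos_diff mult_ac)
  ultimately show ?thesis
    by simp
qed

lemma B_sum_block_ge:
  assumes m: "m \<ge> 1" and H: "H \<le> N"
    and cos: "\<And>n. n \<in> {N - H<..N} \<Longrightarrow>
      cos (2 * pi * real m * (real n * x) powr (1 / real m) + phi m) \<ge> 1 / 2"
  shows "B_sum m x N - B_sum m x (N - H) \<ge> real H * real N powr (- beta m) / 2"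
proof -
  let ?f = "\<lambda>n. real (divisor_fun m n) * real n powr (- beta m) *
        cos (2 * pi * real m * (real n * x) powr (1 / real m) + phi m)"
  \<comment> \<open>The bound is kept as a product of three factors so that \<open>mult_mono\<close>
    compares it with the summand factor by factor.\<close>
  have f: "?f n \<ge> 1 * real N powr (- beta m) * (1 / 2)" if n: "n \<in> {N - H<..N}" for n
  proof (intro mult_mono)
    show "1 \<le> real (divisor_fun m n)"
      using divisor_fun_ge_1[of m n] m n by simp
    show "real N powr (- beta m) \<le> real n powr (- beta m)"
      using n m by (intro powr_mono2') (auto simp: beta_def)
  qed (use cos[OF n] in auto)
  have "{1..N} = {1..N - H} \<union> {N - H<..N}"
    using H by auto
  then have "B_sum m x N = B_sum m x (N - H) + sum ?f {N - H<..N}"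
    unfolding B_sum_def by (simp only:) (rule sum.union_disjoint, auto)
  moreover have "real (card {N - H<..N}) * (1 * real N powr (- beta m) * (1 / 2)) \<le> sum ?f {N - H<..N}"
    by (rule sum_bounded_below) (rule f)
  ultimately show ?thesis
    using H by simp
qed

theorem theorem1p2:
  fixes m :: nat and lam a :: real
  assumes "m \<ge> 2" and "lam > 0" and "0 < a" and "a < real m - 1"
  shows "\<exists>C > 0. \<exists>c1 > 0. \<exists>C1 > 0. \<exists>c2 > 0. \<exists>c3 > 0.
    \<forall>\<^sub>F N :: nat in sequentially.
      \<exists>x \<epsilon> :: real. \<exists>H M :: nat.
        x > 0 \<and> 1 \<le> H \<and> real H < real N / 2 \<and> M \<in> {N - H, N} \<and>
        x = lam * real N powr a * (1 + \<epsilon>) \<and>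
        \<bar>\<epsilon>\<bar> \<le> C * real N powr (- ((a + 1) / real m)) \<and>
        c1 * real N powr (1 - (a + 1) / real m) \<le> real H \<and>
        real H \<le> C1 * real N powr (1 - (a + 1) / real m) \<and>
        \<bar>B_sum m x M\<bar> \<ge> c2 * real N powr Delta m a \<and>
        \<bar>B_sum m x N - B_sum m x (N - H)\<bar> \<ge> c3 * real N powr Delta m a"
proof -
  define \<kappa> L where "\<kappa> = (a + 1) / real m" and "L = lam powr (1 / real m)"
  \<comment> \<open>12 = 6 * 2: the 6 comes from the hypothesis \<open>close\<close> of
    \<open>cos_phase_ge_half\<close>, the 2 from \<open>y \<le> 2 * y0\<close> below.\<close>
  define K where "K = 12 * real m * L"
  have L: "L > 0"
    using assms by (simp add: L_def)
  have K: "K > 0"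
    using L assms by (simp add: K_def)
  \<comment> \<open>The upper bound on \<open>a\<close> gives \<open>\<kappa> < 1\<close>, so that
    the block length, of order \<open>N powr (1 - \<kappa>)\<close>, tends to infinity.\<close>
  have \<kappa>: "0 < \<kappa>" "\<kappa> < 1"
    using assms by (auto simp: \<kappa>_def field_simps)
  have "LIM N sequentially. L * real N powr \<kappa> :> at_top"
    using L \<kappa> by real_asymp
  then have ev1: "\<forall>\<^sub>F N in sequentially. L * real N powr \<kappa> \<ge> 2"
    by (simp add: filterlim_at_top)
  have "LIM N sequentially. real N powr (1 - \<kappa>) :> at_top"
    using \<kappa> by real_asymp
  then have ev2: "\<forall>\<^sub>F N in sequentially. real N powr (1 - \<kappa>) \<ge> K"
    by (simp add: filterlim_at_top)
  \<comment> \<open>\<open>1 / (2 * K)\<close> allows for rounding \<open>H\<close> down; the bound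
    1/2 on the cosines turns it into \<open>1 / (4 * K)\<close>, and passing to one of the two
    partial sums into \<open>1 / (8 * K)\<close>.\<close>
  have ev: "\<forall>\<^sub>F N :: nat in sequentially.
      \<exists>x \<epsilon> :: real. \<exists>H M :: nat.
        x > 0 \<and> 1 \<le> H \<and> real H < real N / 2 \<and> M \<in> {N - H, N} \<and>
        x = lam * real N powr a * (1 + \<epsilon>) \<and>
        \<bar>\<epsilon>\<bar> \<le> 2 / L * real N powr (- ((a + 1) / real m)) \<and>
        1 / (2 * K) * real N powr (1 - (a + 1) / real m) \<le> real H \<and>
        real H \<le> 1 / K * real N powr (1 - (a + 1) / real m) \<and>
        \<bar>B_sum m x M\<bar> \<ge> 1 / (8 * K) * real N powr Delta m a \<and>
        \<bar>B_sum m x N - B_sum m x (N - H)\<bar> \<ge> 1 / (4 * K) * real N powr Delta m a"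
    using ev1 ev2 eventually_gt_at_top[of 0]
  proof eventually_elim
    case (elim N)
    \<comment> \<open>\<open>y0\<close> is the m-th root of \<open>N * x\<close> for the ideal value
      \<open>x = lam * N powr a\<close>. Moving it up to the next \<open>y\<close> whose phase is a
      multiple of \<open>2 * pi\<close> costs at most \<open>1 / m\<close> and makes
      \<open>\<epsilon>\<close> nonnegative.\<close>
    define y0 where "y0 = L * real N powr \<kappa>"
    define k where "k = \<lceil>real m * y0 + phi m / (2 * pi)\<rceil>"
    define y where "y = (of_int k - phi m / (2 * pi)) / real m"
    define x where "x = y ^ m / real N"
    define \<epsilon> where "\<epsilon> = (y / y0) ^ m - 1"
    define H where "H = nat \<lfloor>real N powr (1 - \<kappa>) / K\<rfloor>"
    have y0: "y0 \<ge> 2"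
      using elim by (simp add: y0_def)
    have "real m * y0 \<le> of_int k - phi m / (2 * pi)"
      "of_int k - phi m / (2 * pi) \<le> real m * y0 + 1"
      unfolding k_def by linarith+
    moreover have my: "real m * y = of_int k - phi m / (2 * pi)"
      using assms by (simp add: y_def)
    ultimately have "real m * y0 \<le> real m * y" "real m * y \<le> real m * y0 + 1"
      by simp_all
    then have y: "y0 \<le> y" "y \<le> y0 + 1 / real m"
      using assms by (auto simp: field_simps)
    have phase: "2 * pi * real m * y + phi m = 2 * pi * of_int k"
      using my by (simp add: field_simps)
    have y0_pow: "y0 ^ m = lam * real N powr a * real N"
    proof -
      have "y0 ^ m = y0 powr real m"
        using y0 by (simp add: powr_realpow)
      also have "\<dots> = lam * real N powr (a + 1)"
        using assms elim by (simp add: y0_def L_def \<kappa>_def powr_mult powr_powr)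
      finally show ?thesis
        using elim by (simp add: powr_add)
    qed
    have x_eq: "x = lam * real N powr a * (1 + \<epsilon>)"
      using y0 elim assms by (simp add: x_def \<epsilon>_def power_divide y0_pow)
    have x_pos: "x > 0"
      using y y0 elim by (simp add: x_def)
    have eps: "\<bar>\<epsilon>\<bar> \<le> 2 / L * real N powr (- \<kappa>)"
    proof -
      have "y / y0 \<le> 1 + 1 / (real m * y0)"
        using y y0 assms by (simp add: field_simps)
      \<comment> \<open>Passing to \<open>exp\<close> makes the m-th power harmless: the exponent
        becomes \<open>1 / y0 \<le> 1 / 2\<close>, small enough for
        \<open>exp_bound_lemma\<close>.\<close>
      also have "\<dots> \<le> exp (1 / (real m * y0))"
        by (rule exp_ge_add_one_self)
      finally have "(y / y0) ^ m \<le> exp (1 / (real m * y0)) ^ m"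
        using y y0 by (intro power_mono) auto
      also have "\<dots> = exp (1 / y0)"
        using assms by (simp flip: exp_of_nat_mult)
      also have "\<dots> \<le> 1 + 2 * (1 / y0)"
        using exp_bound_lemma[of "1 / y0"] y0 by simp
      finally have "\<epsilon> \<le> 2 / y0"
        by (simp add: \<epsilon>_def)
      moreover have "\<epsilon> \<ge> 0"
        using y y0 by (simp add: \<epsilon>_def)
      ultimately show ?thesis
        by (simp add: y0_def powr_minus_divide)
    qed
    have z: "real N powr (1 - \<kappa>) / K \<ge> 1"
      using elim K by (simp add: field_simps)
    have H1: "H \<ge> 1"
      using z by (simp add: H_def le_nat_iff)
    have H_upper: "real H \<le> 1 / K * real N powr (1 - \<kappa>)"
      using z by (simp add: H_def)
    have H_lower: "1 / (2 * K) * real N powr (1 - \<kappa>) \<le> real H"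
    proof -
      \<comment> \<open>Adding the two inequalities shows that rounding down loses at most
        half.\<close>
      have "real H \<ge> 1" "real H > real N powr (1 - \<kappa>) / K - 1"
        using H1 z by (auto simp: H_def)
      then show ?thesis
        by simp
    qed
    have "real H * (12 * real m * y0) \<le> 1 / K * real N powr (1 - \<kappa>) * (12 * real m * y0)"
      using H_upper y0 by (intro mult_right_mono) auto
    also have "\<dots> = real N powr (1 - \<kappa>) * real N powr \<kappa>"
      using L assms by (simp add: K_def y0_def)
    also have "\<dots> = real N"
      using elim by (simp flip: powr_add)
    finally have H_y0: "real H * (12 * real m * y0) \<le> real N" .
    have H_half: "real H < real N / 2"
    proof -
      have "real m * y0 \<ge> 1 * 1"
        using assms y0 by (intro mult_mono) auto
      then have "real H * 12 \<le> real H * (12 * real m * y0)"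
        by (intro mult_left_mono) auto
      with H_y0 H1 show ?thesis
        by linarith
    qed
    have block: "B_sum m x N - B_sum m x (N - H) \<ge> real H * real N powr (- beta m) / 2"
    proof (rule B_sum_block_ge)
      fix n assume n: "n \<in> {N - H<..N}"
      have "1 / real m \<le> 1"
        using assms by simp
      then have "y \<le> 2 * y0"
        using y y0 by linarith
      then have "6 * real m * y * real (N - n) \<le> 6 * real m * (2 * y0) * real H"
        using n y0 y by (intro mult_mono) auto
      also have "\<dots> \<le> real N"
        using H_y0 by (simp add: mult_ac)
      finally show "cos (2 * pi * real m * (real n * x) powr (1 / real m) + phi m) \<ge> 1 / 2"
        using n y y0 elim assms phase by (intro cos_phase_ge_half[of m n N y x k]) (auto simp: x_def)
    qed (use assms H_half in auto)
    have "1 - \<kappa> + - beta m = Delta m a"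
      using assms by (simp add: \<kappa>_def beta_def Delta_def field_simps)
    then have "1 / (4 * K) * real N powr Delta m a
        = 1 / (2 * K) * real N powr (1 - \<kappa>) * real N powr (- beta m) / 2"
      by (simp flip: powr_add)
    also have "\<dots> \<le> real H * real N powr (- beta m) / 2"
      by (intro divide_right_mono mult_right_mono H_lower) auto
    finally have diff: "1 / (4 * K) * real N powr Delta m a \<le> \<bar>B_sum m x N - B_sum m x (N - H)\<bar>"
      using block by linarith
    \<comment> \<open>If both partial sums were smaller than this, their difference would be below
      the bound \<open>diff\<close>.\<close>
    then have "\<exists>M\<in>{N - H, N}. 1 / (8 * K) * real N powr Delta m a \<le> \<bar>B_sum m x M\<bar>"
      by (auto simp: abs_if split: if_splits)
    with x_pos x_eq eps H1 H_upper H_lower H_half diff show ?case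
      unfolding \<kappa>_def by blast
  qed
  show ?thesis
    by (rule exI[of _ "2 / L"], rule conjI, use L in simp,
        rule exI[of _ "1 / (2 * K)"], rule conjI, use K in simp,
        rule exI[of _ "1 / K"], rule conjI, use K in simp,
        rule exI[of _ "1 / (8 * K)"], rule conjI, use K in simp,
        rule exI[of _ "1 / (4 * K)"], rule conjI, use K in simp,
        rule ev)
qed

end
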